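(* The O-sequences graph $\mathcal{G}$ is a rooted connected graph without loops. Its root is the O-sequence of multiplicity $1$, i.e. the O-sequence $(1)$.
   Context: Binomial expansion: for positive integers $a,t$ write uniquely $a=\binom{k(t)}{t}+\binom{k(t-1)}{t-1}+\cdots+\binom{k(j)}{j}$ with $k(t)>k(t-1)>\cdots>k(j)\geq j\geq 1$, and set $a^{\langle t\rangle}:=\binom{k(t)+1}{t+1}+\binom{k(t-1)+1}{t}+\cdots+\binom{k(j)+1}{j+1}$; also $0^{\langle t\rangle}:=0$. A function $\mathsf{h}:\mathbb{N}\to\mathbb{N}$ is an O-sequence (admissible) if $\mathsf{h}(0)=1$ and $\mathsf{h}(t+1)\leq \mathsf{h}(t)^{\langle t\rangle}$ for every $t\geq 1$. It is finite if $\mathsf{h}(t)=0$ for some $t$ (and then for all larger arguments); a finite O-sequence is written $(h_0,\ldots,h_{s-1})$ with $h_{s-1}\neq 0$, $s$ is its length, and $e(\mathsf{h})=\sum_{i=0}^{s-1}h_i$ is its multiplicity. Finite sequences are extended by zeros when added or subtracted, and $\mathsf{e}_i$ denotes the sequence that is $1$ at index $i$ (indices starting from $0$) and $0$ elsewhere. The O-sequences graph $\mathcal{G}$ is the directed graph whose vertices are all the finite O-sequences and whose edges are the pairs $(\mathsf{h},\mathsf{h}')$ of finite O-sequences such that $\mathsf{h}'-\mathsf{h}=\mathsf{e}_i$ for some $i$ (edge from $\mathsf{h}$ to $\mathsf{h}'$). "Rooted with root $r$" and "connected" mean that every vertex can be reached from $r$ by a directed path; a loop is an edge from a vertex to itself.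 *)

theory Defs
  imports Main "Graph_Theory.Digraph"
begin

section \<open>Binomial expansions\<close>

text \<open>Only the values of \<open>k\<close> on \<open>{j..t}\<close> matter; they and \<open>j\<close> are uniquely determined by
  \<open>a\<close> and \<open>t\<close>, see \<open>binomial_expansion_exists\<close> and \<open>binomial_expansion_unique\<close> below.\<close>

definition binomial_expansion :: "nat \<Rightarrow> nat \<Rightarrow> (nat \<Rightarrow> nat) \<Rightarrow> nat \<Rightarrow> bool" where
  "binomial_expansion a t k j \<longleftrightarrow>
     1 \<le> j \<and> j \<le> t \<and> j \<le> k j \<and> strict_mono_on {j..t} k \<and> a = (\<Sum>i=j..t. k i choose i)"

lemma binomial_expansion_ge:
  assumes "binomial_expansion a t k j" "j \<le> i" "i \<le> t"
  shows "i \<le> k i"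
  using assms(2,3)
proof (induction i rule: dec_induct)
  case base
  then show ?case using assms(1) by (simp add: binomial_expansion_def)
next
  case (step n)
  have "k n < k (Suc n)"
    using assms(1) step by (auto simp: binomial_expansion_def strict_mono_on_def)
  with step show ?case by simp
qed

lemma binomial_expansion_Suc:
  assumes "binomial_expansion a (Suc t) k j" "j \<le> t"
  obtains b where "binomial_expansion b t k j" "a = b + (k (Suc t) choose Suc t)"
    "k t < k (Suc t)"
proof
  show "binomial_expansion (\<Sum>i=j..t. k i choose i) t k j"
    using assms by (auto simp: binomial_expansion_def strict_mono_on_def)
  show "a = (\<Sum>i=j..t. k i choose i) + (k (Suc t) choose Suc t)"
    using assms by (simp add: binomial_expansion_def)
  show "k t < k (Suc t)"
    using assms by (auto simp: binomial_expansion_def strict_mono_on_def)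
qed

lemma binomial_expansion_bounds:
  assumes "binomial_expansion a t k j"
  shows "(k t choose t) \<le> a" "a < (Suc (k t) choose t)" "0 < a"
proof -
  have "(k t choose t) \<le> a \<and> a < (Suc (k t) choose t)"
    using assms
  proof (induction t arbitrary: a)
    case 0
    then have False unfolding binomial_expansion_def by linarith
    then show ?case ..
  next
    case (Suc t)
    have k: "Suc t \<le> k (Suc t)"
      using binomial_expansion_ge[OF Suc.prems, of "Suc t"] Suc.prems
      by (simp add: binomial_expansion_def)
    show ?case
    proof (cases "j = Suc t")
      case True
      then have "a = (k (Suc t) choose Suc t)"
        using Suc.prems by (simp add: binomial_expansion_def)
      then show ?thesis using k by simp
    next
      case False
      then have "j \<le> t" using Suc.prems by (simp add: binomial_expansion_def)
      then obtain b where b: "binomial_expansion b t k j" "a = b + (k (Suc t) choose Suc t)"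
        "k t < k (Suc t)"
        using binomial_expansion_Suc[OF Suc.prems] by blast
      have "b < (Suc (k t) choose t)" using Suc.IH[OF b(1)] by simp
      also have "\<dots> \<le> (k (Suc t) choose t)" using b(3) by (intro binomial_right_mono) auto
      finally show ?thesis using b(2) by simp
    qed
  qed
  moreover have "0 < (k t choose t)"
    using binomial_expansion_ge[OF assms, of t] assms
    by (simp add: binomial_expansion_def zero_less_binomial)
  ultimately show "(k t choose t) \<le> a" "a < (Suc (k t) choose t)" "0 < a" by linarith+
qed

lemma binomial_expansion_unique:
  assumes "binomial_expansion a t k j" "binomial_expansion a t k' j'"
  shows "j = j' \<and> (\<forall>i\<in>{j..t}. k i = k' i)"
  using assms
proof (induction t arbitrary: a)
  case 0
  then show ?case by (simp add: binomial_expansion_def)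
next
  case (Suc t)
  have le: "x (Suc t) \<le> y (Suc t)"
    if "binomial_expansion a (Suc t) x i" "binomial_expansion a (Suc t) y i'" for x y i i'
  proof (rule ccontr)
    assume "\<not> ?thesis"
    then have "(Suc (y (Suc t)) choose Suc t) \<le> (x (Suc t) choose Suc t)"
      by (intro binomial_right_mono) auto
    with binomial_expansion_bounds[OF that(1)] binomial_expansion_bounds[OF that(2)]
    show False by simp
  qed
  have eq: "k (Suc t) = k' (Suc t)"
    using le Suc.prems by (meson le_antisym)
  have top: "a = (x (Suc t) choose Suc t)" if "binomial_expansion a (Suc t) x (Suc t)" for x
    using that by (simp add: binomial_expansion_def)
  have below: "\<exists>b. binomial_expansion b t x i \<and> a = b + (x (Suc t) choose Suc t) \<and> 0 < b"
    if "binomial_expansion a (Suc t) x i" "i \<noteq> Suc t" for x i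
  proof -
    have "i \<le> t" using that by (simp add: binomial_expansion_def)
    then show ?thesis
      using binomial_expansion_Suc[OF that(1)] binomial_expansion_bounds(3) by metis
  qed
  consider "j = Suc t" "j' = Suc t" | "j = Suc t" "j' \<noteq> Suc t" | "j \<noteq> Suc t" "j' = Suc t"
    | "j \<noteq> Suc t" "j' \<noteq> Suc t" by blast
  then show ?case
  proof cases
    case 1
    then show ?thesis using eq by simp
  next
    case 2
    then show ?thesis using top[of k] below[OF Suc.prems(2)] Suc.prems(1) eq by auto
  next
    case 3
    then show ?thesis using top[of k'] below[OF Suc.prems(1)] Suc.prems(2) eq by auto
  next
    case 4
    then obtain b b' where "binomial_expansion b t k j" "a = b + (k (Suc t) choose Suc t)"
      "binomial_expansion b' t k' j'" "a = b' + (k' (Suc t) choose Suc t)"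
      using below Suc.prems by metis
    then have "j = j' \<and> (\<forall>i\<in>{j..t}. k i = k' i)" using Suc.IH eq by simp
    then show ?thesis using eq by (auto simp: le_Suc_eq)
  qed
qed

lemma binomial_expansion_exists:
  assumes "0 < a" "0 < t"
  shows "\<exists>k j. binomial_expansion a t k j"
  using assms
proof (induction t arbitrary: a)
  case 0
  then show ?case by simp
next
  case (Suc t)
  let ?P = "\<lambda>m. (m choose Suc t) \<le> a"
  have bnd: "m \<le> a + t" if "?P m" for m
  proof (rule ccontr)
    assume "\<not> ?thesis"
    then have "(Suc (a + t) choose Suc t) \<le> (m choose Suc t)" by (intro binomial_right_mono) auto
    moreover have "a < (Suc (a + t) choose Suc t)"
    proof (induction a)
      case 0
      then show ?case by simp
    next
      case (Suc a)
      have "0 < (Suc (a + t) choose t)" by (intro zero_less_binomial) simp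
      moreover have "(Suc (Suc a + t) choose Suc t)
          = (Suc (a + t) choose t) + (Suc (a + t) choose Suc t)" by simp
      ultimately show ?case using Suc by linarith
    qed
    ultimately show False using that by simp
  qed
  define m where "m = (GREATEST m. ?P m)"
  have P0: "?P (Suc t)" using Suc.prems by simp
  have m: "?P m" unfolding m_def using GreatestI_nat[of ?P, OF P0] bnd by blast
  have m_ge: "Suc t \<le> m" unfolding m_def using Greatest_le_nat[of ?P, OF P0] bnd by blast
  have m_less: "a < (Suc m choose Suc t)"
  proof (rule ccontr)
    assume "\<not> ?thesis"
    then have "?P (Suc m)" by linarith
    then have "Suc m \<le> m" using Greatest_le_nat[of ?P "Suc m" "a + t"] bnd unfolding m_def by blast
    then show False by simp
  qed
  show ?case
  proof (cases "a = (m choose Suc t)")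
    case True
    then have "binomial_expansion a (Suc t) (\<lambda>_. m) (Suc t)"
      using m_ge by (simp add: binomial_expansion_def strict_mono_on_def)
    then show ?thesis by blast
  next
    case False
    define b where "b = a - (m choose Suc t)"
    have b: "0 < b" "a = b + (m choose Suc t)" "b < (m choose t)"
      using False m m_less by (auto simp: b_def)
    have "0 < t" using b(1,3) by (cases t) auto
    then obtain k j where kj: "binomial_expansion b t k j" using Suc.IH b(1) by blast
    have "k t < m"
    proof (rule ccontr)
      assume "\<not> ?thesis"
      then have "(m choose t) \<le> (k t choose t)" by (intro binomial_right_mono) auto
      then show False using binomial_expansion_bounds(1)[OF kj] b(3) by simp
    qed
    moreover have "k i \<le> k t" if "i \<in> {j..t}" for i
      using kj that by (cases "i = t") (auto simp: binomial_expansion_def strict_mono_on_def intro!: less_imp_le)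
    ultimately have "k i < m" if "i \<in> {j..t}" for i using that by fastforce
    then have "strict_mono_on {j..Suc t} (k(Suc t := m))"
      using kj by (auto simp: binomial_expansion_def strict_mono_on_def)
    moreover have "(\<Sum>i=j..t. (k(Suc t := m)) i choose i) = (\<Sum>i=j..t. k i choose i)"
      by (intro sum.cong) auto
    ultimately have "binomial_expansion a (Suc t) (k(Suc t := m)) j"
      using kj b(2) by (auto simp: binomial_expansion_def)
    then show ?thesis by blast
  qed
qed

text \<open>\<open>a\<^bsup>\<langle>t\<rangle>\<^esup>\<close>, meaningful for \<open>t \<ge> 1\<close>.\<close>

definition macaulay_power :: "nat \<Rightarrow> nat \<Rightarrow> nat" where
  "macaulay_power a t =
     (if a = 0 then 0
      else THE b. \<exists>k j. binomial_expansion a t k j \<and> b = (\<Sum>i=j..t. Suc (k i) choose Suc i))"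

lemma macaulay_power_eq:
  assumes "binomial_expansion a t k j"
  shows "macaulay_power a t = (\<Sum>i=j..t. Suc (k i) choose Suc i)"
proof -
  have "a \<noteq> 0" using binomial_expansion_bounds(3)[OF assms] by simp
  moreover have "(THE b. \<exists>k j. binomial_expansion a t k j \<and> b = (\<Sum>i=j..t. Suc (k i) choose Suc i))
      = (\<Sum>i=j..t. Suc (k i) choose Suc i)"
  proof (rule the_equality)
    show "\<exists>k' j'. binomial_expansion a t k' j' \<and>
        (\<Sum>i=j..t. Suc (k i) choose Suc i) = (\<Sum>i=j'..t. Suc (k' i) choose Suc i)"
      using assms by blast
  next
    fix b
    assume "\<exists>k' j'. binomial_expansion a t k' j' \<and> b = (\<Sum>i=j'..t. Suc (k' i) choose Suc i)"
    then obtain k' j' where kj: "binomial_expansion a t k' j'"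
      and b: "b = (\<Sum>i=j'..t. Suc (k' i) choose Suc i)" by blast
    show "b = (\<Sum>i=j..t. Suc (k i) choose Suc i)"
      unfolding b using binomial_expansion_unique[OF assms kj] by (intro sum.cong) auto
  qed
  ultimately show ?thesis unfolding macaulay_power_def by (simp only: if_False)
qed


section \<open>O-sequences\<close>

definition O_sequence :: "(nat \<Rightarrow> nat) \<Rightarrow> bool" where
  "O_sequence h \<longleftrightarrow> h 0 = 1 \<and> (\<forall>t\<ge>1. h (t + 1) \<le> macaulay_power (h t) t)"

definition finite_O_sequence :: "(nat \<Rightarrow> nat) \<Rightarrow> bool" where
  "finite_O_sequence h \<longleftrightarrow> O_sequence h \<and> (\<exists>t. h t = 0)"

text \<open>An O-sequence that vanishes at some \<open>t\<close> vanishes from \<open>t\<close> on, so its length is the first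
  index at which it vanishes.\<close>

definition seq_length :: "(nat \<Rightarrow> nat) \<Rightarrow> nat" where
  "seq_length h = (LEAST t. h t = 0)"

definition multiplicity_of :: "(nat \<Rightarrow> nat) \<Rightarrow> nat" where
  "multiplicity_of h = (\<Sum>i<seq_length h. h i)"

text \<open>The tuple \<open>(h\<^sub>0, \<dots>, h\<^bsub>s-1\<^esub>)\<close>, extended by zeros.\<close>

definition seq_of_list :: "nat list \<Rightarrow> nat \<Rightarrow> nat" where
  "seq_of_list hs i = (if i < length hs then hs ! i else 0)"

definition unit_seq :: "nat \<Rightarrow> nat \<Rightarrow> int" where
  "unit_seq i n = (if n = i then 1 else 0)"


section \<open>The O-sequences graph\<close>

text \<open>Differences are taken in the integers, since subtraction of natural numbers truncates.\<close>

definition O_seq_graph :: "(nat \<Rightarrow> nat, (nat \<Rightarrow> nat) \<times> (nat \<Rightarrow> nat)) pre_digraph" where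
  "O_seq_graph =
     \<lparr>verts = {h. finite_O_sequence h},
      arcs = {(h, h'). finite_O_sequence h \<and> finite_O_sequence h' \<and>
                       (\<exists>i. (\<lambda>n. int (h' n) - int (h n)) = unit_seq i)},
      tail = fst, head = snd\<rparr>"

definition is_root :: "('a, 'b) pre_digraph \<Rightarrow> 'a \<Rightarrow> bool" where
  "is_root G r \<longleftrightarrow> r \<in> verts G \<and> (\<forall>v\<in>verts G. r \<rightarrow>\<^sup>*\<^bsub>G\<^esub> v)"

end

theory Submission
  imports Defs
begin

text \<open>Lowering the last nonzero entry of a finite O-sequence \<open>h \<noteq> (1)\<close> by one preserves
  admissibility: the bound on that entry is only relaxed, and the following entry is zero. Iterating,
  \<open>h\<close> descends to \<open>(1)\<close>. No edge enters \<open>(1)\<close>, because every O-sequence starts with \<open>1\<close>, so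
  \<open>(1)\<close> is the only root.\<close>

lemma O_sequence_zero_mono:
  assumes "O_sequence h" "h t = 0" "t \<le> n"
  shows "h n = 0"
  using assms(3)
proof (induction n rule: dec_induct)
  case base
  then show ?case using assms(2) .
next
  case (step n)
  \<comment> \<open>The growth bound is available only for arguments at least 1;
    \<open>h 0 = 1\<close> excludes 0.\<close>
  have "n \<noteq> 0" using assms(1) step.IH by (auto simp: O_sequence_def intro!: gr0I)
  then have "h (n + 1) \<le> macaulay_power (h n) n"
    using assms(1) by (simp add: O_sequence_def)
  \<comment> \<open>By the convention that \<open>macaulay_power 0 n\<close> is 0, a zero entry
    forces the next one to vanish.\<close>
  then show ?case using step.IH by (simp add: macaulay_power_def)
qed

lemma finite_O_sequence_seq_length:
  assumes "finite_O_sequence h"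
  shows "h n = 0 \<longleftrightarrow> seq_length h \<le> n"
proof
  show "seq_length h \<le> n" if "h n = 0"
    unfolding seq_length_def using that by (rule Least_le)
  have "h (seq_length h) = 0"
    using assms unfolding finite_O_sequence_def seq_length_def by (metis (mono_tags) LeastI)
  then show "h n = 0" if "seq_length h \<le> n"
    using O_sequence_zero_mono assms that unfolding finite_O_sequence_def by blast
qed

lemma finite_O_sequence_0: "finite_O_sequence h \<Longrightarrow> h 0 = 1"
  by (simp add: finite_O_sequence_def O_sequence_def)

lemma seq_of_list_one: "seq_of_list [Suc 0] n = (if n = 0 then 1 else 0)"
  by (simp add: seq_of_list_def)

lemma finite_O_sequence_one: "finite_O_sequence (seq_of_list [1])"
  unfolding finite_O_sequence_def O_sequence_def
  by (auto simp: seq_of_list_one intro!: exI[of _ 1])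

text \<open>Entries from the length on are zero. This allows sequences of different lengths to be
  summed over one common range.\<close>

lemma multiplicity_of_eq_sum:
  assumes "finite_O_sequence h" "seq_length h \<le> N"
  shows "multiplicity_of h = (\<Sum>i<N. h i)"
  unfolding multiplicity_of_def
  using assms finite_O_sequence_seq_length[OF assms(1)]
  by (intro sum.mono_neutral_left) auto

lemma seq_length_eq_1_iff:
  assumes "finite_O_sequence h"
  shows "seq_length h = 1 \<longleftrightarrow> h = seq_of_list [1]"
proof
  assume "seq_length h = 1"
  then show "h = seq_of_list [1]"
    using finite_O_sequence_0[OF assms] finite_O_sequence_seq_length[OF assms]
    by (auto simp: fun_eq_iff seq_of_list_one)
next
  assume "h = seq_of_list [1]"
  then have "seq_length h \<le> n \<longleftrightarrow> 1 \<le> n" for n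
    using finite_O_sequence_seq_length[OF assms, of n] by (auto simp: seq_of_list_one split: if_splits)
  then show "seq_length h = 1" by (meson le_antisym order_refl)
qed

lemma seq_length_pos:
  assumes "finite_O_sequence h"
  shows "0 < seq_length h"
  using finite_O_sequence_seq_length[OF assms, of 0] finite_O_sequence_0[OF assms] by auto

lemma multiplicity_of_eq_1_iff:
  assumes "finite_O_sequence h"
  shows "multiplicity_of h = 1 \<longleftrightarrow> h = seq_of_list [1]"
proof
  assume "h = seq_of_list [1]"
  moreover from this have "seq_length h = 1" using seq_length_eq_1_iff[OF assms] by simp
  ultimately show "multiplicity_of h = 1" by (simp add: multiplicity_of_def seq_of_list_one)
next
  assume mult: "multiplicity_of h = 1"
  \<comment> \<open>Each entry before the length is at least 1, so the multiplicity bounds the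
    length.\<close>
  have "seq_length h = (\<Sum>i<seq_length h. 1)" by simp
  also have "\<dots> \<le> multiplicity_of h"
    unfolding multiplicity_of_def
    using finite_O_sequence_seq_length[OF assms]
    by (intro sum_mono) (metis One_nat_def Suc_leI gr0I lessThan_iff not_le)
  finally have "seq_length h = 1" using mult seq_length_pos[OF assms] by simp
  then show "h = seq_of_list [1]" using seq_length_eq_1_iff[OF assms] by simp
qed

text \<open>Trades the integer difference for a function update, so that later arguments stay within
  the natural numbers.\<close>

lemma dominates_O_seq_graph_iff:
  "h \<rightarrow>\<^bsub>O_seq_graph\<^esub> h' \<longleftrightarrow> finite_O_sequence h \<and> finite_O_sequence h' \<and> (\<exists>i. h' = h(i := Suc (h i)))"
proof -
  have "(\<lambda>n. int (h' n) - int (h n)) = unit_seq i \<longleftrightarrow> h' = h(i := Suc (h i))" for i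
    by (auto simp: fun_eq_iff unit_seq_def split: if_splits)
  then show ?thesis
    by (auto simp: arcs_ends_def arc_to_ends_def O_seq_graph_def image_iff)
qed

text \<open>Multiplicity thus grades the graph: this excludes loops, isolates \<open>(1)\<close>
  from incoming edges and supplies the measure for descending to the root.\<close>

lemma multiplicity_of_dominates:
  assumes "h \<rightarrow>\<^bsub>O_seq_graph\<^esub> h'"
  shows "multiplicity_of h' = Suc (multiplicity_of h)"
proof -
  obtain i where fin: "finite_O_sequence h" "finite_O_sequence h'" and h': "h' = h(i := Suc (h i))"
    using assms by (auto simp: dominates_O_seq_graph_iff)
  \<comment> \<open>Large enough that both sums below \<open>N\<close> are full multiplicities and
    the raised index \<open>i\<close> is counted.\<close>
  define N where "N = Suc (i + seq_length h + seq_length h')"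
  have N: "i < N" "seq_length h \<le> N" "seq_length h' \<le> N" by (simp_all add: N_def)
  have "(\<Sum>n<N. h' n) = (\<Sum>n<N. h n + (if n = i then 1 else 0))"
    unfolding h' by (intro sum.cong) auto
  also have "\<dots> = Suc (\<Sum>n<N. h n)"
    unfolding sum.distrib by (simp add: N)
  finally show ?thesis
    using multiplicity_of_eq_sum[OF fin(1) N(2)] multiplicity_of_eq_sum[OF fin(2) N(3)]
    by simp
qed

lemma not_dominates_one: "\<not> h \<rightarrow>\<^bsub>O_seq_graph\<^esub> seq_of_list [1]"
proof
  assume dom: "h \<rightarrow>\<^bsub>O_seq_graph\<^esub> seq_of_list [1]"
  then have fin: "finite_O_sequence h" by (simp add: dominates_O_seq_graph_iff)
  \<comment> \<open>A predecessor of \<open>(1)\<close> would have multiplicity 0, although its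
    entry at index 0 already contributes 1.\<close>
  have "multiplicity_of h = 0"
    using multiplicity_of_dominates[OF dom] multiplicity_of_eq_1_iff[OF finite_O_sequence_one]
    by simp
  then show False
    using seq_length_pos[OF fin] finite_O_sequence_0[OF fin] by (auto simp: multiplicity_of_def)
qed

lemma exists_dominates:
  assumes "finite_O_sequence h" "h \<noteq> seq_of_list [1]"
  shows "\<exists>g. g \<rightarrow>\<^bsub>O_seq_graph\<^esub> h"
proof -
  \<comment> \<open>The index of the last nonzero entry. It is positive because \<open>h\<close>
    differs from \<open>(1)\<close>, so lowering there keeps the leading 1.\<close>
  define m where "m = seq_length h - 1"
  have m: "0 < m" "seq_length h = Suc m"
    using seq_length_pos[OF assms(1)] seq_length_eq_1_iff[OF assms(1)] assms(2)
    by (auto simp: m_def)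
  have zero_iff: "h n = 0 \<longleftrightarrow> Suc m \<le> n" for n
    using finite_O_sequence_seq_length[OF assms(1)] m(2) by simp
  define g where "g = h(m := h m - 1)"
  have "g (t + 1) \<le> macaulay_power (g t) t" if "1 \<le> t" for t
  \<comment> \<open>Only at \<open>t = m\<close> does the right-hand side change, and there the
    left-hand side is zero.\<close>
  proof (cases "t = m")
    case True
    then have "g (t + 1) = 0" using zero_iff by (simp add: g_def)
    then show ?thesis by simp
  next
    case False
    have "g (t + 1) \<le> h (t + 1)" by (simp add: g_def)
    also have "\<dots> \<le> macaulay_power (h t) t"
      using assms(1) that by (simp add: finite_O_sequence_def O_sequence_def)
    finally show ?thesis using False by (simp add: g_def)
  qed
  moreover have "g 0 = 1" using finite_O_sequence_0[OF assms(1)] m(1) by (simp add: g_def)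
  moreover have "g (Suc m) = 0" using zero_iff by (simp add: g_def)
  ultimately have "finite_O_sequence g"
    unfolding finite_O_sequence_def O_sequence_def by blast
  \<comment> \<open>Since \<open>h m\<close> is nonzero, the subtraction in \<open>g\<close> did not
    truncate and can be undone.\<close>
  moreover have "h = g(m := Suc (g m))"
    using zero_iff[of m] by (auto simp: g_def fun_eq_iff)
  ultimately show ?thesis using assms(1) dominates_O_seq_graph_iff by blast
qed

lemma wf_digraph_O_seq_graph: "wf_digraph O_seq_graph"
  by unfold_locales (auto simp: O_seq_graph_def)

lemma loopfree_digraph_O_seq_graph: "loopfree_digraph O_seq_graph"
proof -
  interpret wf_digraph O_seq_graph by (rule wf_digraph_O_seq_graph)
  show ?thesis
  proof
    fix e assume "e \<in> arcs O_seq_graph"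
    then have "tail O_seq_graph e \<rightarrow>\<^bsub>O_seq_graph\<^esub> head O_seq_graph e"
      by (auto simp: arcs_ends_conv)
    then show "tail O_seq_graph e \<noteq> head O_seq_graph e"
      using multiplicity_of_dominates by fastforce
  qed
qed

lemma is_root_one: "is_root O_seq_graph (seq_of_list [1])"
proof -
  interpret wf_digraph O_seq_graph by (rule wf_digraph_O_seq_graph)
  have one: "seq_of_list [1] \<in> verts O_seq_graph"
    using finite_O_sequence_one by (simp add: O_seq_graph_def)
  have "seq_of_list [1] \<rightarrow>\<^sup>*\<^bsub>O_seq_graph\<^esub> h" if "finite_O_sequence h" for h
    using that
  \<comment> \<open>A predecessor has smaller multiplicity, so a path to it from \<open>(1)\<close>
    exists and is extended by one edge.\<close>
  proof (induction "multiplicity_of h" arbitrary: h rule: less_induct)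
    case less
    show ?case
    proof (cases "h = seq_of_list [1]")
      case True
      then show ?thesis using one by simp
    next
      case False
      then obtain g where g: "g \<rightarrow>\<^bsub>O_seq_graph\<^esub> h" using exists_dominates less.prems by blast
      then have "finite_O_sequence g" by (simp add: dominates_O_seq_graph_iff)
      then have "seq_of_list [1] \<rightarrow>\<^sup>*\<^bsub>O_seq_graph\<^esub> g"
        using less.hyps multiplicity_of_dominates[OF g] by simp
      then show ?thesis using g by (rule reachable_adj_trans)
    qed
  qed
  then show ?thesis using one by (simp add: is_root_def O_seq_graph_def)
qed

text \<open>A root must reach \<open>(1)\<close>. A nontrivial path would end with an edge into
  \<open>(1)\<close>, so the path is trivial.\<close>

lemma is_root_unique:
  assumes "is_root O_seq_graph r"
  shows "r = seq_of_list [1]"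
proof -
  have "r \<rightarrow>\<^sup>*\<^bsub>O_seq_graph\<^esub> seq_of_list [1]"
    using assms is_root_one by (simp add: is_root_def)
  then show ?thesis
    unfolding reachable_def
    by (cases rule: rtrancl_on.cases) (use not_dominates_one in auto)
qed

theorem proposition2p2:
  shows "loopfree_digraph O_seq_graph \<and>
         (\<exists>!r. is_root O_seq_graph r) \<and>
         is_root O_seq_graph (seq_of_list [1]) \<and>
         {h \<in> verts O_seq_graph. multiplicity_of h = 1} = {seq_of_list [1]}"
proof (intro conjI)
  show "loopfree_digraph O_seq_graph" by (rule loopfree_digraph_O_seq_graph)
  show "\<exists>!r. is_root O_seq_graph r" using is_root_one is_root_unique by blast
  show "is_root O_seq_graph (seq_of_list [1])" by (rule is_root_one)
  show "{h \<in> verts O_seq_graph. multiplicity_of h = 1} = {seq_of_list [1]}"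
    using multiplicity_of_eq_1_iff finite_O_sequence_one by (auto simp: O_seq_graph_def)
qed

end
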